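(* Let signs $\sigma,\sigma_1,\sigma_2,\sigma_3,\sigma_4\in\{\pm1\}$ be given. The following estimates hold, with implicit constants independent of the dyadic numbers. (i) With $\phi=\sigma\langle n_1+n_2+n_3\rangle+\sigma_1\langle n_1\rangle+\sigma_2\langle n_2\rangle+\sigma_3\langle n_3\rangle$, for any dyadic numbers $N_1,N_2,N_3$, $$\sup_{m\in\mathbb Z}\#\{(n_1,n_2,n_3):|\phi-m|\le1,\ |n_i|\sim N_i,\ i=1,2,3\}\lesssim\frac{(N_1N_2N_3)^2}{\mathrm{med}\{N_1,N_2,N_3\}^{1/2}}.$$ (ii) With $\phi$ as in (i) where $n_3=n_{123}-n_1-n_2$, for any dyadic numbers $N_{123},N_1,N_2$, $$\sup_{m\in\mathbb Z}\#\{(n_1,n_2,n_{123}):|\phi-m|\le1,\ |n_1|\sim N_1,\ |n_2|\sim N_2,\ |n_{123}|\sim N_{123}\}\lesssim\frac{(N_{123}N_1N_2)^2}{\mathrm{med}\{N_{123},N_1,N_2\}^{1/2}}.$$ (iii) With $\psi=\sigma\langle n_2+n_3+n_4\rangle+\sigma_2\langle n_2\rangle+\sigma_3\langle n_3\rangle+\sigma_4\langle n_4\rangle$ where $n_4=n_{34}-n_3$, for any dyadic numbers $N_2,N_3,N_{34}$, $$\sup_{m\in\mathbb Z}\#\{(n_2,n_3,n_{34}):|\psi-m|\le1,\ |n_2|\sim N_2,\ |n_3|\sim N_3,\ |n_{34}|\sim N_{34}\}\lesssim\frac{(N_2N_3N_{34})^2}{\min\{N_{34},\max\{N_2,N_3\}\}^{1/2}}.$$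 (iv) With $\psi$ as in (iii) where $n_4=n_{34}-n_3$ and $n_2=n_{234}-n_{34}$, for any dyadic numbers $N_3,N_{34},N_{234}\ge1$, $$\sup_{m\in\mathbb Z}\#\{(n_3,n_{34},n_{234}):|\psi-m|\le1,\ |n_3|\sim N_3,\ |n_{34}|\sim N_{34},\ |n_{234}|\sim N_{234}\}\lesssim\frac{(N_3N_{34}N_{234})^2}{\min\{N_{34},\max\{N_3,N_{234}\}\}^{1/2}}.$$
   Context: All $n$'s range over $\mathbb Z^2$; $\langle n\rangle=\sqrt{1+|n|^2}$. Dyadic numbers are of the form $2^k$, $k\in\mathbb N$. $|n|\sim N$ means $\frac12N\le|n|\le2N$. $\mathrm{med}\{a,b,c\}$ is the middle of the three numbers. *)

theory Defs
  imports "HOL-Analysis.Analysis"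
begin

text \<open>The lattice \<open>\<int>\<^sup>2\<close> is the type \<^typ>\<open>int \<times> int\<close> with componentwise addition; since it carries
  no norm in the library, the Euclidean norm is taken through the embedding into
  \<^typ>\<open>real \<times> real\<close>.\<close>

definition znorm :: "int \<times> int \<Rightarrow> real" where
  "znorm n = norm (real_of_int (fst n), real_of_int (snd n))"

definition jbracket :: "int \<times> int \<Rightarrow> real" where
  "jbracket n = sqrt (1 + (znorm n)\<^sup>2)"

text \<open>The exponent 0 is included, so 1 is dyadic.\<close>

definition dyadic :: "real \<Rightarrow> bool" where
  "dyadic N \<longleftrightarrow> (\<exists>k::nat. N = 2 ^ k)"

definition at_scale :: "int \<times> int \<Rightarrow> real \<Rightarrow> bool" where
  "at_scale n N \<longleftrightarrow> 1 / 2 * N \<le> znorm n \<and> znorm n \<le> 2 * N"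

definition med :: "real \<Rightarrow> real \<Rightarrow> real \<Rightarrow> real" where
  "med a b c = sort [a, b, c] ! 1"

text \<open>Both \<open>\<phi>\<close> (with arguments \<open>n\<^sub>1, n\<^sub>2, n\<^sub>3\<close>) and \<open>\<psi>\<close> (with arguments \<open>n\<^sub>2, n\<^sub>3, n\<^sub>4\<close>)
  are instances of this function.\<close>

definition phase ::
  "real \<Rightarrow> real \<Rightarrow> real \<Rightarrow> real \<Rightarrow> int \<times> int \<Rightarrow> int \<times> int \<Rightarrow> int \<times> int \<Rightarrow> real" where
  "phase s s1 s2 s3 a b c =
     s * jbracket (a + b + c) + s1 * jbracket a + s2 * jbracket b + s3 * jbracket c"

text \<open>A lattice point at a given scale ranges over a finite set, so all cardinalities of sets
  of triples at given scales are genuine.\<close>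

lemma finite_at_scale: "finite {n. at_scale n N}"
proof (rule finite_subset)
  show "{n. at_scale n N} \<subseteq> {- \<lceil>2 * N\<rceil>..\<lceil>2 * N\<rceil>} \<times> {- \<lceil>2 * N\<rceil>..\<lceil>2 * N\<rceil>}"
  proof
    fix n :: "int \<times> int"
    assume "n \<in> {n. at_scale n N}"
    then have le: "znorm n \<le> 2 * N"
      by (simp add: at_scale_def)
    have "\<bar>real_of_int (fst n)\<bar> \<le> 2 * N" "\<bar>real_of_int (snd n)\<bar> \<le> 2 * N"
      using le
        norm_snd_le[of "real_of_int (snd n)" "real_of_int (fst n)"]
        norm_fst_le[of "real_of_int (fst n)" "real_of_int (snd n)"]
      by (auto simp: znorm_def)
    then have "\<bar>fst n\<bar> \<le> \<lceil>2 * N\<rceil>" "\<bar>snd n\<bar> \<le> \<lceil>2 * N\<rceil>"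
      by linarith+
    then show "n \<in> {- \<lceil>2 * N\<rceil>..\<lceil>2 * N\<rceil>} \<times> {- \<lceil>2 * N\<rceil>..\<lceil>2 * N\<rceil>}"
      by (cases n) auto
  qed
qed simp

lemma finite_scale_triples:
  "finite {(a, b, c). P a b c \<and> at_scale a A \<and> at_scale b B \<and> at_scale c C}"
  by (rule finite_subset[of _ "{n. at_scale n A} \<times> {n. at_scale n B} \<times> {n. at_scale n C}"])
    (auto intro: finite_at_scale)

end

theory Submission
  imports Defs
begin

text \<open>
  Everything reduces to one two-dimensional counting estimate. For a fixed shift \<open>b\<close>, a sign \<open>s\<close>
  and a real \<open>m\<close>, the number of lattice points \<open>n\<close> with \<open>\<bar>n\<bar> \<le> 2N\<close> and
  \<open>\<bar>\<langle>n + b\<rangle> + s \<langle>n\<rangle> - m\<bar> \<le> 1\<close> is at most a constant times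
  \<open>N\<^sup>2 (N powr (-1/2) + \<langle>b\<rangle> powr (-1/2))\<close> (\<open>card_phase_shift_le\<close>). The region in question is a thickened
  ellipse or hyperbola with axis along \<open>b\<close>, so coordinates along and across \<open>b\<close> are natural:
  with \<open>\<beta> = \<bar>b\<bar>\<close> and \<open>n = (x, y)\<close> in these coordinates, the phase
  \<open>\<langle>(x + \<beta>, y)\<rangle> + s \<langle>(x, y)\<rangle>\<close> depends on \<open>y\<close> through \<open>y\<^sup>2\<close> only, and its difference
  quotient in the variable \<open>y\<^sup>2\<close> is explicitly \<open>1 / (A + A') + s / (B + B')\<close>, where \<open>A, A'\<close> and \<open>B, B'\<close>
  are the values of the two brackets at the two points. In absolute value it is at least a constant times the
  smaller of \<open>1/N\<close> and \<open>\<beta> \<bar>x + \<beta>/2\<bar> / N\<^sup>3\<close> (\<open>difference_quotient_lower_bound\<close>); the second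
  quantity accounts for the degeneration of the hyperbolas near the bisector \<open>x = -\<beta>/2\<close>. So on
  each line \<open>x = const\<close> the squares \<open>y\<^sup>2\<close> lie in an interval of controlled length \<open>K\<close>, which
  leaves room for \<open>O(1 + sqrt K)\<close> integers \<open>y\<close>. Summing over the lines costs only the sum of
  \<open>\<bar>x + \<beta>/2\<bar> powr (-1/2)\<close> over \<open>O(N)\<close> values of \<open>x\<close>, cut off at distance \<open>1\<close>
  from the bisector, which is \<open>O(sqrt N)\<close>. The rotation does not preserve the lattice, but rounding the rotated coordinates moves the brackets, which are
  1-Lipschitz, by a bounded amount and is at most nine-to-one.

  For triples, one frequency is counted by this estimate while the other two are fixed. When two of
  \<open>n\<^sub>1, n\<^sub>2, n\<^sub>3\<close> live at scales \<open>N\<^sub>1 \<ge> N\<^sub>2\<close>, counting \<open>n\<^sub>1\<close> with shift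
  \<open>b = n\<^sub>2 + n\<^sub>3\<close> and summing \<open>\<langle>n\<^sub>2 + n\<^sub>3\<rangle> powr (-1/2)\<close> over \<open>n\<^sub>2\<close> gains
  \<open>N\<^sub>2 powr (-1/2)\<close>. Applied to the two largest scales this gains the median, which is (i). In (ii)
  the four frequencies \<open>n\<^sub>1, n\<^sub>2, n\<^sub>3, -n\<^sub>1\<^sub>2\<^sub>3\<close> sum to zero and play symmetric roles, so (ii) is (i)
  after relabelling. In (iii) the shift is \<open>\<plusminus>n\<^sub>3\<^sub>4\<close> for both \<open>n\<^sub>2\<close> and \<open>n\<^sub>3\<close>, hence of size comparable to
  \<open>N\<^sub>3\<^sub>4\<close>, and counting the one with the larger scale gives the claim. The substitution
  \<open>n\<^sub>2 \<mapsto> -n\<^sub>2\<^sub>3\<^sub>4\<close> turns (iv) into (iii). The numerical constants are crude throughout.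
\<close>

section \<open>Sums of inverse square roots and integers with close squares\<close>

lemma sum_inverse_sqrt_le:
  "(\<Sum>p<n. 1 / sqrt (max 1 (real p))) \<le> 1 + 2 * sqrt (real n)"
proof -
  have "(\<Sum>p<Suc k. 1 / sqrt (max 1 (real p))) \<le> 1 + 2 * sqrt (real k)" for k
  proof (induction k)
    case (Suc k)
    let ?u = "sqrt (real k)" and ?v = "sqrt (real (Suc k))"
    have uv: "0 \<le> ?u" "?u \<le> ?v" "0 < ?v" "?v * ?v = ?u * ?u + 1"
      by auto
    have "0 \<le> (?v - ?u)\<^sup>2"
      by simp
    then have "1 \<le> 2 * (?v - ?u) * ?v"
      using uv(4) by (simp add: power2_eq_square algebra_simps)
    then have "1 / ?v \<le> 2 * (?v - ?u)"
      using uv(3) by (simp add: divide_le_eq)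
    then show ?case
      using Suc.IH by simp
  qed simp
  note bound = this
  show ?thesis
  proof (cases n)
    case (Suc k)
    have "sqrt (real k) \<le> sqrt (real (Suc k))"
      by simp
    then show ?thesis
      using bound[of k] unfolding Suc by linarith
  qed simp
qed

text \<open>Only the number of terms enters the bound, not the position of \<open>F\<close> relative to \<open>-x\<close>: at most two
  integers lie at distance in \<open>[k, k + 1)\<close> from \<open>-x\<close>, so the worst case is \<open>F\<close> clustered around \<open>-x\<close>,
  where the sum behaves like that of \<open>k powr (-1/2)\<close>. This uniformity makes it possible to use the
  bound for every shift, however large.\<close>
lemma sum_int_inverse_sqrt_le:
  fixes F :: "int set" and x :: real
  assumes "finite F"
  shows "(\<Sum>i\<in>F. 1 / sqrt (max 1 \<bar>real_of_int i + x\<bar>)) \<le> 7 * sqrt (real (card F))"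
proof (cases "card F = 0")
  case True
  then show ?thesis using assms by simp
next
  case False
  define n where "n = card F"
  have n: "1 \<le> n"
    using False n_def by simp
  define w where "w i = 1 / sqrt (max 1 \<bar>real_of_int i + x\<bar>)" for i :: int
  define p where "p i = nat \<lfloor>\<bar>real_of_int i + x\<bar>\<rfloor>" for i :: int
  define near where "near = {i \<in> F. p i < n}"
  have p: "real (p i) \<le> \<bar>real_of_int i + x\<bar>" "\<bar>real_of_int i + x\<bar> < real (p i) + 1" for i
    unfolding p_def by linarith+
  have w0: "0 \<le> w i" for i
    by (simp add: w_def)
  have fin: "finite near" "near \<subseteq> F"
    using assms by (auto simp: near_def)
  have fibre: "(\<Sum>i\<in>{i\<in>near. p i = k}. w i) \<le> 2 * (1 / sqrt (max 1 (real k)))" for k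
  proof -
    \<comment> \<open>The first integer at or above \<open>k - x\<close> and the last one at or below \<open>-k - x\<close>.\<close>
    have sub: "{i\<in>near. p i = k} \<subseteq> {\<lceil>real k - x\<rceil>, \<lfloor>- real k - x\<rfloor>}"
    proof
      fix i assume "i \<in> {i\<in>near. p i = k}"
      then have "real k \<le> \<bar>real_of_int i + x\<bar>" "\<bar>real_of_int i + x\<bar> < real k + 1"
        using p[of i] by auto
      then have "i = \<lceil>real k - x\<rceil> \<or> i = \<lfloor>- real k - x\<rfloor>"
        by linarith
      then show "i \<in> {\<lceil>real k - x\<rceil>, \<lfloor>- real k - x\<rfloor>}"
        by simp
    qed
    have c2: "card {i\<in>near. p i = k} \<le> 2"
      using card_mono[OF _ sub] card_insert_le_m1[of 2 "{\<lfloor>- real k - x\<rfloor>}" "\<lceil>real k - x\<rceil>"] by simp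
    have "(\<Sum>i\<in>{i\<in>near. p i = k}. w i) \<le> real (card {i\<in>near. p i = k}) * (1 / sqrt (max 1 (real k)))"
    proof (rule sum_bounded_above)
      fix i assume "i \<in> {i\<in>near. p i = k}"
      then have "max 1 (real k) \<le> max 1 \<bar>real_of_int i + x\<bar>"
        using p[of i] by auto
      then show "w i \<le> 1 / sqrt (max 1 (real k))"
        unfolding w_def by (intro divide_left_mono) (auto simp: max_def)
    qed
    also have "\<dots> \<le> 2 * (1 / sqrt (max 1 (real k)))"
      using c2 by (intro mult_right_mono) auto
    finally show ?thesis .
  qed
  have "(\<Sum>i\<in>near. w i) = (\<Sum>k\<in>{..<n}. \<Sum>i\<in>{i\<in>near. p i = k}. w i)"
    by (rule sum.group[symmetric]) (use fin in \<open>auto simp: near_def\<close>)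
  also have "\<dots> \<le> (\<Sum>k<n. 2 * (1 / sqrt (max 1 (real k))))"
    by (intro sum_mono fibre)
  also have "\<dots> \<le> 2 * (1 + 2 * sqrt (real n))"
    unfolding sum_distrib_left[symmetric] using sum_inverse_sqrt_le[of n] by simp
  finally have 1: "(\<Sum>i\<in>near. w i) \<le> 2 * (1 + 2 * sqrt (real n))" .
  have "(\<Sum>i\<in>F - near. w i) \<le> real (card (F - near)) * (1 / sqrt (real n))"
  proof (rule sum_bounded_above)
    fix i assume "i \<in> F - near"
    then have "real n \<le> real (p i)"
      by (auto simp: near_def)
    then have "real n \<le> max 1 \<bar>real_of_int i + x\<bar>"
      using p(1)[of i] by linarith
    then show "w i \<le> 1 / sqrt (real n)"
      unfolding w_def using n by (intro divide_left_mono) auto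
  qed
  also have "\<dots> \<le> real n * (1 / sqrt (real n))"
    unfolding n_def by (intro mult_right_mono) (auto intro: card_mono assms)
  also have "\<dots> = sqrt (real n)"
    by (simp add: real_div_sqrt)
  finally have 2: "(\<Sum>i\<in>F - near. w i) \<le> sqrt (real n)" .
  have "(\<Sum>i\<in>F. w i) = (\<Sum>i\<in>F - near. w i) + (\<Sum>i\<in>near. w i)"
    by (rule sum.subset_diff) (use fin assms in auto)
  also have "\<dots> \<le> 2 + 5 * sqrt (real n)"
    using 1 2 by simp
  also have "\<dots> \<le> 7 * sqrt (real n)"
    using n by simp
  finally show ?thesis
    by (simp add: w_def n_def)
qed

lemma card_ints_between_le:
  fixes S :: "int set"
  assumes "\<And>i j. i \<in> S \<Longrightarrow> j \<in> S \<Longrightarrow> real_of_int \<bar>i - j\<bar> \<le> L" "0 \<le> L"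
  shows "real (card S) \<le> 1 + L"
proof (cases "S = {} \<or> infinite S")
  case True
  then show ?thesis using assms(2) by auto
next
  case False
  then have S: "finite S" "Min S \<in> S" by auto
  have "S \<subseteq> {Min S..Min S + \<lfloor>L\<rfloor>}"
  proof
    fix i assume i: "i \<in> S"
    have "Min S \<le> i" using S i by simp
    moreover have "i - Min S \<le> \<lfloor>L\<rfloor>"
      using assms(1)[OF i S(2)] by linarith
    ultimately show "i \<in> {Min S..Min S + \<lfloor>L\<rfloor>}" by simp
  qed
  then have "card S \<le> card {Min S..Min S + \<lfloor>L\<rfloor>}"
    by (rule card_mono[rotated]) simp
  moreover have "real (card {Min S..Min S + \<lfloor>L\<rfloor>}) \<le> 1 + L"
    using assms(2) by simp
  ultimately show ?thesis by linarith
qed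

text \<open>For integers of equal sign, \<open>\<bar>i - j\<bar>\<^sup>2 \<le> \<bar>i - j\<bar> \<bar>i + j\<bar> = \<bar>i\<^sup>2 - j\<^sup>2\<bar>\<close>.\<close>
lemma card_ints_near_squares_le:
  fixes J :: "int set"
  assumes "finite J" "\<And>i j. i \<in> J \<Longrightarrow> j \<in> J \<Longrightarrow> real_of_int \<bar>i\<^sup>2 - j\<^sup>2\<bar> \<le> K" "0 \<le> K"
  shows "real (card J) \<le> 2 + 2 * sqrt K"
proof -
  have diff: "real_of_int \<bar>i - j\<bar> \<le> sqrt K" if "i \<in> J" "j \<in> J" "0 \<le> i * j" for i j
  proof (rule real_le_rsqrt)
    have "\<bar>i - j\<bar> \<le> \<bar>i + j\<bar>"
      using that(3) by (auto simp: zero_le_mult_iff)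
    then have "\<bar>i - j\<bar> * \<bar>i - j\<bar> \<le> \<bar>i - j\<bar> * \<bar>i + j\<bar>"
      by (intro mult_left_mono) auto
    also have "\<dots> = \<bar>i\<^sup>2 - j\<^sup>2\<bar>"
      by (simp add: abs_mult[symmetric] power2_eq_square algebra_simps)
    finally have "(real_of_int \<bar>i - j\<bar>)\<^sup>2 \<le> real_of_int \<bar>i\<^sup>2 - j\<^sup>2\<bar>"
      unfolding power2_eq_square by (metis of_int_le_iff of_int_mult)
    then show "(real_of_int \<bar>i - j\<bar>)\<^sup>2 \<le> K"
      using assms(2)[OF that(1,2)] by linarith
  qed
  have 1: "real (card {j\<in>J. 0 \<le> j}) \<le> 1 + sqrt K"
    by (rule card_ints_between_le) (use diff assms(3) in auto)
  have 2: "real (card {j\<in>J. j < 0}) \<le> 1 + sqrt K"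
    by (rule card_ints_between_le) (use diff assms(3) in \<open>auto simp: mult_nonpos_nonpos\<close>)
  have "card J \<le> card {j\<in>J. 0 \<le> j} + card {j\<in>J. j < 0}"
    by (rule order_trans[OF card_mono card_Un_le]) (use assms(1) in auto)
  then show ?thesis
    using 1 2 by linarith
qed

lemma card_le_fibres:
  assumes "finite P" "q ` S \<subseteq> P" "\<And>p. p \<in> P \<Longrightarrow> real (card {x\<in>S. q x = p}) \<le> h p"
    and "finite S"
  shows "real (card S) \<le> (\<Sum>p\<in>P. h p)"
proof -
  have "real (card S) = (\<Sum>x\<in>S. 1)"
    by simp
  also have "\<dots> = (\<Sum>p\<in>P. \<Sum>x\<in>{x\<in>S. q x = p}. 1)"
    by (rule sum.group[symmetric]) (use assms in auto)
  also have "\<dots> \<le> (\<Sum>p\<in>P. h p)"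
    by (intro sum_mono) (use assms(3) in simp)
  finally show ?thesis .
qed

section \<open>The phase along a line orthogonal to the shift\<close>
definition bracket :: "real \<Rightarrow> real \<Rightarrow> real" where
  "bracket x y = sqrt (1 + x\<^sup>2 + y\<^sup>2)"

lemma bracket_ge: "1 \<le> bracket x y" "\<bar>x\<bar> \<le> bracket x y" "\<bar>y\<bar> \<le> bracket x y"
  unfolding bracket_def by (auto intro!: real_le_rsqrt)

lemma bracket_sq: "bracket x y * bracket x y = 1 + x\<^sup>2 + y\<^sup>2"
  unfolding bracket_def by simp

lemma bracket_lipschitz: "\<bar>bracket x y - bracket x' y'\<bar> \<le> \<bar>x - x'\<bar> + \<bar>y - y'\<bar>"
proof -
  have eq: "bracket u v = norm (1::real, u, v)" for u v
    by (simp add: bracket_def norm_Pair add.assoc)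
  have "\<bar>bracket x y - bracket x' y'\<bar> \<le> norm ((1::real, x, y) - (1, x', y'))"
    unfolding eq by (rule norm_triangle_ineq3)
  also have "\<dots> \<le> \<bar>x - x'\<bar> + \<bar>y - y'\<bar>"
    using sqrt_sum_squares_le_sum_abs[of "x - x'" "y - y'"] by (simp add: norm_Pair)
  finally show ?thesis .
qed

lemma jbracket_eq: "jbracket n = bracket (real_of_int (fst n)) (real_of_int (snd n))"
  by (simp add: jbracket_def bracket_def znorm_def norm_Pair add.assoc)

text \<open>If \<open>f(y) = A + s B\<close> with \<open>A = \<langle>(x + \<beta>, y)\<rangle>\<close> and \<open>B = \<langle>(x, y)\<rangle>\<close>, and if primes denote the
  values at \<open>y'\<close>, then \<open>A - A' = (y\<^sup>2 - y'\<^sup>2) / (A + A')\<close>, and likewise for \<open>B\<close>. So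
  \<open>1 / (A + A') + s / (B + B')\<close> is the difference quotient of \<open>f\<close> in the variable \<open>y\<^sup>2\<close>, and the lemma
  bounds its inverse from above. Cancellation is possible only for \<open>s = -1\<close> and \<open>A + A'\<close> at most
  comparable to \<open>B + B'\<close>; then all brackets are \<open>O(N)\<close>, and the identity \<open>A\<^sup>2 - B\<^sup>2 = 2 \<beta> t\<close>, where
  \<open>t = x + \<beta>/2\<close>, keeps \<open>A - B\<close> and \<open>A' - B'\<close> away from zero with the same sign, so that they cannot
  compensate each other.\<close>
lemma difference_quotient_lower_bound:
  fixes s :: real
  assumes pos: "0 < A" "0 < A'" "0 < B" "0 < B'" and le: "B \<le> 5 * N" "B' \<le> 5 * N"
    and s: "s \<in> {1, -1}"
    and diff: "A * A - B * B = 2 * \<beta> * t" "A' * A' - B' * B' = 2 * \<beta> * t"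
    and bt: "0 < \<beta>" "t \<noteq> 0"
  shows "1 \<le> (20 * N + 3000 * N^3 / (\<beta> * \<bar>t\<bar>)) * \<bar>1 / (A + A') + s / (B + B')\<bar>"
proof -
  define a c where "a = A + A'" and "c = B + B'"
  have ac: "0 < a" "0 < c" "c \<le> 10 * N"
    using pos le by (auto simp: a_def c_def)
  have N: "0 < N"
    using ac by linarith
  have r0: "0 \<le> 3000 * N^3 / (\<beta> * \<bar>t\<bar>)"
    using N bt by simp
  have large: ?thesis if "1 / (2 * c) \<le> \<bar>1 / a + s / c\<bar>"
  proof -
    have "1 \<le> 20 * N * (1 / (2 * c))"
      using ac by (simp add: field_simps)
    also have "\<dots> \<le> (20 * N + 3000 * N^3 / (\<beta> * \<bar>t\<bar>)) * \<bar>1 / a + s / c\<bar>"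
      by (intro mult_mono that) (use r0 N ac in auto)
    finally show ?thesis
      by (simp add: a_def c_def)
  qed
  consider (plus) "s = 1" | (far) "s = -1" "2 * c \<le> a" | (near) "s = -1" "a < 2 * c"
    using s by fastforce
  then show ?thesis
  proof cases
    case plus
    have "1 / (2 * c) \<le> 1 / c" "0 < 1 / a"
      using ac by (auto simp: field_simps)
    then have "1 / (2 * c) \<le> \<bar>1 / a + s / c\<bar>"
      unfolding plus by linarith
    then show ?thesis
      by (rule large)
  next
    case far
    have "1 / a \<le> 1 / (2 * c)"
      using far ac by (intro divide_left_mono) auto
    moreover have "1 / c = 1 / (2 * c) + 1 / (2 * c)"
      using ac by (simp add: field_simps)
    ultimately have "1 / (2 * c) \<le> \<bar>1 / a + s / c\<bar>"
      using far(1) by simp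
    then show ?thesis
      by (rule large)
  next
    case near
    have quot: "A - B = 2 * \<beta> * t / (A + B)" "A' - B' = 2 * \<beta> * t / (A' + B')"
      using diff pos by (auto simp: field_simps)
    have "\<bar>a - c\<bar> = 2 * \<beta> * \<bar>t\<bar> * (1 / (A + B) + 1 / (A' + B'))"
    proof -
      have "a - c = 2 * \<beta> * t * (1 / (A + B) + 1 / (A' + B'))"
        using quot by (simp add: a_def c_def field_simps)
      then show ?thesis
        using pos bt by (simp add: abs_mult)
    qed
    also have "\<dots> \<ge> 2 * \<beta> * \<bar>t\<bar> * (1 / (30 * N))"
    proof (intro mult_left_mono)
      have "1 / (30 * N) \<le> 1 / (A + B)"
        using pos near ac by (intro divide_left_mono) (auto simp: a_def c_def)
      then show "1 / (30 * N) \<le> 1 / (A + B) + 1 / (A' + B')"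
        using pos by (simp add: add_increasing2)
    qed (use bt in auto)
    finally have num: "\<beta> * \<bar>t\<bar> / (15 * N) \<le> \<bar>a - c\<bar>"
      by (simp add: field_simps)
    have den: "a * c \<le> 200 * N^2"
    proof -
      have "a * c \<le> (20 * N) * (10 * N)"
        by (intro mult_mono) (use near ac N in auto)
      then show ?thesis
        by (simp add: power2_eq_square)
    qed
    have "\<beta> * \<bar>t\<bar> / (3000 * N^3) = (\<beta> * \<bar>t\<bar> / (15 * N)) / (200 * N^2)"
      by (simp add: power2_eq_square power3_eq_cube)
    also have "\<dots> \<le> \<bar>a - c\<bar> / (a * c)"
      by (intro frac_le num den) (use ac in auto)
    also have "\<dots> = \<bar>1 / a + s / c\<bar>"
    proof -
      have "1 / a + s / c = (c - a) / (a * c)"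
        using near ac by (simp add: field_simps)
      then show ?thesis
        using ac by (simp add: abs_divide abs_minus_commute)
    qed
    finally have low: "\<beta> * \<bar>t\<bar> / (3000 * N^3) \<le> \<bar>1 / a + s / c\<bar>" .
    have "1 = 3000 * N^3 / (\<beta> * \<bar>t\<bar>) * (\<beta> * \<bar>t\<bar> / (3000 * N^3))"
      using N bt by simp
    also have "\<dots> \<le> (20 * N + 3000 * N^3 / (\<beta> * \<bar>t\<bar>)) * \<bar>1 / a + s / c\<bar>"
      by (intro mult_mono low) (use r0 N bt in auto)
    finally show ?thesis
      by (simp add: a_def c_def)
  qed
qed

lemma squares_close_on_line:
  fixes x y y' :: real
  assumes s: "s \<in> {1, -1}" and \<beta>: "0 < \<beta>" and t: "x + \<beta> / 2 \<noteq> 0"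
    and le: "bracket x y \<le> 5 * N" "bracket x y' \<le> 5 * N"
    and f: "\<bar>bracket (x + \<beta>) y + s * bracket x y - m\<bar> \<le> 5"
           "\<bar>bracket (x + \<beta>) y' + s * bracket x y' - m\<bar> \<le> 5"
  shows "\<bar>y\<^sup>2 - y'\<^sup>2\<bar> \<le> 200 * N + 30000 * N^3 / (\<beta> * \<bar>x + \<beta> / 2\<bar>)"
proof -
  define A A' B B' where "A = bracket (x + \<beta>) y" and "A' = bracket (x + \<beta>) y'"
    and "B = bracket x y" and "B' = bracket x y'"
  define K where "K = 20 * N + 3000 * N^3 / (\<beta> * \<bar>x + \<beta> / 2\<bar>)"
  define slope where "slope = 1 / (A + A') + s / (B + B')"
  have pos: "0 < A" "0 < A'" "0 < B" "0 < B'"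
    using bracket_ge(1) unfolding A_def A'_def B_def B'_def by (meson less_le_trans zero_less_one)+
  have "A * A - A' * A' = y\<^sup>2 - y'\<^sup>2" "B * B - B' * B' = y\<^sup>2 - y'\<^sup>2"
    unfolding A_def A'_def B_def B'_def bracket_sq by auto
  then have "A - A' = (y\<^sup>2 - y'\<^sup>2) / (A + A')" "B - B' = (y\<^sup>2 - y'\<^sup>2) / (B + B')"
    using pos by (auto simp: field_simps)
  moreover have "(A + s * B) - (A' + s * B') = (A - A') + s * (B - B')"
    by (simp add: algebra_simps)
  ultimately have "(A + s * B) - (A' + s * B') = (y\<^sup>2 - y'\<^sup>2) * slope"
    by (simp add: slope_def distrib_left)
  moreover have "\<bar>(A + s * B) - (A' + s * B')\<bar> \<le> 10"
    using f unfolding A_def A'_def B_def B'_def by linarith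
  ultimately have ten: "\<bar>y\<^sup>2 - y'\<^sup>2\<bar> * \<bar>slope\<bar> \<le> 10"
    by (simp add: abs_mult)
  have one: "1 \<le> K * \<bar>slope\<bar>"
    unfolding K_def slope_def
  proof (rule difference_quotient_lower_bound)
    show "A * A - B * B = 2 * \<beta> * (x + \<beta> / 2)" "A' * A' - B' * B' = 2 * \<beta> * (x + \<beta> / 2)"
      unfolding A_def A'_def B_def B'_def bracket_sq by (auto simp: power2_eq_square algebra_simps)
  qed (use pos le s \<beta> t in \<open>auto simp: B_def B'_def\<close>)
  have K: "0 \<le> K"
    using bracket_ge(1)[of x y] le \<beta> by (simp add: K_def)
  have "\<bar>y\<^sup>2 - y'\<^sup>2\<bar> * 1 \<le> \<bar>y\<^sup>2 - y'\<^sup>2\<bar> * (K * \<bar>slope\<bar>)"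
    by (intro mult_left_mono one) auto
  also have "\<dots> = K * (\<bar>y\<^sup>2 - y'\<^sup>2\<bar> * \<bar>slope\<bar>)"
    by simp
  also have "\<dots> \<le> K * 10"
    by (intro mult_left_mono ten K)
  finally show ?thesis
    by (simp add: K_def)
qed

section \<open>Lattice points with prescribed phase for a fixed shift\<close>

text \<open>Close to the bisector, where \<open>\<bar>i + \<beta>/2\<bar> < 1\<close>, the phase may be nearly constant along the line
  and all \<open>O(N)\<close> integers \<open>j\<close> may occur. But there \<open>\<beta>\<close> is \<open>O(N)\<close>, so the second term on the right,
  with the weight \<open>1\<close>, still dominates \<open>N\<close>.\<close>
lemma card_line_le:
  fixes i :: int and \<beta> m :: real
  assumes N: "1 \<le> N" and \<beta>: "1 \<le> \<beta>" and s: "s \<in> {1, -1}"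
  defines "J \<equiv> {j::int. bracket i j \<le> 5 * N \<and> \<bar>bracket (i + \<beta>) j + s * bracket i j - m\<bar> \<le> 5}"
  shows "finite J"
    and "real (card J) \<le> 32 * sqrt N + 348 * (N * sqrt N / sqrt \<beta>) * (1 / sqrt (max 1 \<bar>i + \<beta> / 2\<bar>))"
proof -
  have sub: "J \<subseteq> {- \<lfloor>5 * N\<rfloor>..\<lfloor>5 * N\<rfloor>}"
  proof
    fix j assume "j \<in> J"
    then have "\<bar>real_of_int j\<bar> \<le> 5 * N"
      using bracket_ge(3)[of j i] by (auto simp: J_def)
    then show "j \<in> {- \<lfloor>5 * N\<rfloor>..\<lfloor>5 * N\<rfloor>}"
      by (auto simp: le_floor_iff abs_le_iff minus_le_iff)
  qed
  show fin: "finite J"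
    by (rule finite_subset[OF sub]) simp
  define t where "t = i + \<beta> / 2"
  have sN: "1 \<le> sqrt N" "sqrt N * sqrt N = N" and s\<beta>: "1 \<le> sqrt \<beta>" "sqrt \<beta> * sqrt \<beta> = \<beta>"
    using N \<beta> by auto
  show "real (card J) \<le> 32 * sqrt N + 348 * (N * sqrt N / sqrt \<beta>) * (1 / sqrt (max 1 \<bar>i + \<beta> / 2\<bar>))"
  proof (cases "1 \<le> \<bar>t\<bar>")
    case True
    define K where "K = 200 * N + 30000 * N^3 / (\<beta> * \<bar>t\<bar>)"
    have K: "0 \<le> 200 * N" "0 \<le> 30000 * N^3 / (\<beta> * \<bar>t\<bar>)"
      using N \<beta> by auto
    have "real (card J) \<le> 2 + 2 * sqrt K"
    proof (rule card_ints_near_squares_le[OF fin])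
      fix j j' assume "j \<in> J" "j' \<in> J"
      then have "\<bar>(real_of_int j)\<^sup>2 - (real_of_int j')\<^sup>2\<bar> \<le> K"
        unfolding K_def t_def
        by (intro squares_close_on_line[where m = m and s = s]) (use s True \<beta> in \<open>auto simp: J_def t_def\<close>)
      then show "real_of_int \<bar>j\<^sup>2 - j'\<^sup>2\<bar> \<le> K"
        by simp
    qed (use K in \<open>simp add: K_def\<close>)
    also have "sqrt K \<le> sqrt (200 * N) + sqrt (30000 * N^3 / (\<beta> * \<bar>t\<bar>))"
      unfolding K_def by (rule sqrt_add_le_add_sqrt[OF K])
    also have "sqrt (200 * N) \<le> 15 * sqrt N"
      by (rule real_le_lsqrt) (use N sN in \<open>auto simp: power_mult_distrib\<close>)
    also have "sqrt (30000 * N^3 / (\<beta> * \<bar>t\<bar>)) \<le> 174 * (N * sqrt N / sqrt \<beta>) * (1 / sqrt \<bar>t\<bar>)"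
    proof (rule real_le_lsqrt)
      have "(174 * (N * sqrt N / sqrt \<beta>) * (1 / sqrt \<bar>t\<bar>))\<^sup>2 =
            30276 * (N\<^sup>2 * (sqrt N)\<^sup>2 / ((sqrt \<beta>)\<^sup>2 * (sqrt \<bar>t\<bar>)\<^sup>2))"
        by (simp add: power_mult_distrib power_divide)
      also have "\<dots> = 30276 * (N^3 / (\<beta> * \<bar>t\<bar>))"
        using N \<beta> by (simp add: power2_eq_square[of N] power3_eq_cube)
      finally have "(174 * (N * sqrt N / sqrt \<beta>) * (1 / sqrt \<bar>t\<bar>))\<^sup>2 = 30276 * (N^3 / (\<beta> * \<bar>t\<bar>))" .
      then show "30000 * N^3 / (\<beta> * \<bar>t\<bar>) \<le> (174 * (N * sqrt N / sqrt \<beta>) * (1 / sqrt \<bar>t\<bar>))\<^sup>2"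
        using K by simp
    qed (use K N \<beta> in auto)
    finally have "real (card J) \<le> 2 + 30 * sqrt N + 348 * (N * sqrt N / sqrt \<beta>) * (1 / sqrt \<bar>t\<bar>)"
      by simp
    also have "\<dots> \<le> 32 * sqrt N + 348 * (N * sqrt N / sqrt \<beta>) * (1 / sqrt \<bar>t\<bar>)"
      by (rule add_right_mono) (use sN(1) in linarith)
    also have "\<bar>t\<bar> = max 1 \<bar>i + \<beta> / 2\<bar>"
      using True by (simp add: t_def)
    finally show ?thesis .
  next
    case False
    show ?thesis
    proof (cases "J = {}")
      case True
      then show ?thesis using N \<beta> by simp
    next
      case False
      then obtain j where "j \<in> J" by auto
      then have "\<bar>real_of_int i\<bar> \<le> 5 * N"
        using bracket_ge(2)[of i j] by (auto simp: J_def)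
      then have "\<beta> \<le> 12 * N"
        using \<open>\<not> 1 \<le> \<bar>t\<bar>\<close> N unfolding t_def by (auto simp: abs_if split: if_splits)
      then have "sqrt \<beta> \<le> 4 * sqrt N"
        by (intro real_le_lsqrt) (use N \<beta> sN in \<open>auto simp: power_mult_distrib\<close>)
      then have "N * sqrt \<beta> \<le> N * (4 * sqrt N)"
        using N by (intro mult_left_mono) auto
      then have "N \<le> 4 * (N * sqrt N / sqrt \<beta>)"
        using s\<beta> by (simp add: field_simps)
      moreover have "real (card J) \<le> 11 * N"
      proof -
        have "card J \<le> card {- \<lfloor>5 * N\<rfloor>..\<lfloor>5 * N\<rfloor>}"
          by (rule card_mono[OF _ sub]) simp
        moreover have "real (card {- \<lfloor>5 * N\<rfloor>..\<lfloor>5 * N\<rfloor>}) \<le> 2 * (5 * N) + 1"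
          using N by simp
        ultimately show ?thesis using N by linarith
      qed
      moreover have "0 \<le> N * sqrt N / sqrt \<beta>"
        using N \<beta> by simp
      ultimately have "real (card J) \<le> 32 * sqrt N + 348 * (N * sqrt N / sqrt \<beta>)"
        using sN(1) by linarith
      moreover have "max 1 \<bar>i + \<beta> / 2\<bar> = 1"
        using \<open>\<not> 1 \<le> \<bar>t\<bar>\<close> by (simp add: t_def)
      ultimately show ?thesis
        by simp
    qed
  qed
qed

lemma card_cells_le:
  fixes \<beta> m :: real
  assumes N: "1 \<le> N" and \<beta>: "1 \<le> \<beta>" and s: "s \<in> {1, -1}"
  defines "P \<equiv> {(i::int, j::int). bracket i j \<le> 5 * N \<and>
                  \<bar>bracket (i + \<beta>) j + s * bracket i j - m\<bar> \<le> 5}"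
  shows "finite P" and "real (card P) \<le> 10000 * (N\<^sup>2 * (1 / sqrt N + 1 / sqrt \<beta>))"
proof -
  define I where "I = {- \<lfloor>5 * N\<rfloor>..\<lfloor>5 * N\<rfloor>}"
  define J where "J i = {j::int. bracket i j \<le> 5 * N \<and>
                  \<bar>bracket (i + \<beta>) j + s * bracket i j - m\<bar> \<le> 5}" for i :: int
  define w where "w i = 1 / sqrt (max 1 \<bar>real_of_int i + \<beta> / 2\<bar>)" for i :: int
  have P: "P = (SIGMA i:I. J i)"
  proof -
    have "i \<in> I" if "j \<in> J i" for i j
    proof -
      have "\<bar>real_of_int i\<bar> \<le> 5 * N"
        using that bracket_ge(2)[of i j] by (auto simp: J_def)
      then show ?thesis
        unfolding I_def by (auto simp: le_floor_iff abs_le_iff minus_le_iff)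
    qed
    then show ?thesis
      by (auto simp: P_def J_def)
  qed
  have finI: "finite I" and finJ: "finite (J i)" for i
    using card_line_le(1)[OF N \<beta> s] by (auto simp: I_def J_def)
  then show "finite P"
    unfolding P by auto
  have cI: "real (card I) \<le> 11 * N"
  proof -
    have "real (card I) \<le> 2 * (5 * N) + 1"
      using N by (simp add: I_def)
    then show ?thesis using N by linarith
  qed
  have sN: "1 \<le> sqrt N" "sqrt N * sqrt N = N"
    using N by auto
  have "sqrt (real (card I)) \<le> sqrt (16 * N)"
    using cI N by simp
  then have sI: "sqrt (real (card I)) \<le> 4 * sqrt N"
    by (simp add: real_sqrt_mult)
  define v where "v = N * sqrt N / sqrt \<beta>"
  have v: "0 \<le> v"
    using N \<beta> by (simp add: v_def)
  have "real (card P) = (\<Sum>i\<in>I. real (card (J i)))"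
    unfolding P using finI finJ by simp
  also have "\<dots> \<le> (\<Sum>i\<in>I. 32 * sqrt N + 348 * v * w i)"
    unfolding J_def w_def v_def by (intro sum_mono card_line_le(2)[OF N \<beta> s])
  also have "\<dots> = real (card I) * (32 * sqrt N) + 348 * v * (\<Sum>i\<in>I. w i)"
    by (simp add: sum.distrib sum_distrib_left)
  also have "\<dots> \<le> 11 * N * (32 * sqrt N) + 348 * v * (7 * (4 * sqrt N))"
  proof (intro add_mono mult_right_mono mult_left_mono cI)
    show "(\<Sum>i\<in>I. w i) \<le> 7 * (4 * sqrt N)"
      using sum_int_inverse_sqrt_le[OF finI, of "\<beta> / 2"] sI by (simp add: w_def)
  qed (use N v in auto)
  also have "\<dots> = 352 * (N * sqrt N) + 9744 * (sqrt N * v)"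
    by simp
  also have "N * sqrt N = N\<^sup>2 / sqrt N"
    using sN N by (simp add: field_simps power2_eq_square)
  also have "sqrt N * v = N\<^sup>2 / sqrt \<beta>"
    using sN by (simp add: v_def power2_eq_square)
  also have "352 * (N\<^sup>2 / sqrt N) + 9744 * (N\<^sup>2 / sqrt \<beta>) \<le> 10000 * (N\<^sup>2 * (1 / sqrt N + 1 / sqrt \<beta>))"
    using N \<beta> by (simp add: distrib_left add_mono divide_right_mono)
  finally show "real (card P) \<le> 10000 * (N\<^sup>2 * (1 / sqrt N + 1 / sqrt \<beta>))" .
qed

lemma finite_znorm_le: "finite {n. znorm n \<le> R}"
  and card_znorm_le: "1 \<le> N \<Longrightarrow> real (card {n. znorm n \<le> 2 * N}) \<le> 25 * N\<^sup>2"
  and znorm_le_subset: "{n. znorm n \<le> R} \<subseteq> {- \<lfloor>R\<rfloor>..\<lfloor>R\<rfloor>} \<times> {- \<lfloor>R\<rfloor>..\<lfloor>R\<rfloor>}"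
proof -
  show sub: "{n. znorm n \<le> R} \<subseteq> {- \<lfloor>R\<rfloor>..\<lfloor>R\<rfloor>} \<times> {- \<lfloor>R\<rfloor>..\<lfloor>R\<rfloor>}" for R
  proof
    fix n assume "n \<in> {n. znorm n \<le> R}"
    then have "\<bar>real_of_int (fst n)\<bar> \<le> R" "\<bar>real_of_int (snd n)\<bar> \<le> R"
      using norm_snd_le[of "real_of_int (snd n)" "real_of_int (fst n)"]
        norm_fst_le[of "real_of_int (fst n)" "real_of_int (snd n)"]
      by (auto simp: znorm_def)
    then show "n \<in> {- \<lfloor>R\<rfloor>..\<lfloor>R\<rfloor>} \<times> {- \<lfloor>R\<rfloor>..\<lfloor>R\<rfloor>}"
      by (cases n) (auto simp: le_floor_iff abs_le_iff minus_le_iff)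
  qed
  show "finite {n. znorm n \<le> R}"
    by (rule finite_subset[OF sub]) simp
  show "real (card {n. znorm n \<le> 2 * N}) \<le> 25 * N\<^sup>2" if N: "1 \<le> N"
  proof -
    define F where "F = {- \<lfloor>2 * N\<rfloor>..\<lfloor>2 * N\<rfloor>}"
    have "real (card F) \<le> 2 * (2 * N) + 1"
      using N by (simp add: F_def)
    then have F: "real (card F) \<le> 5 * N"
      using N by linarith
    have "card {n. znorm n \<le> 2 * N} \<le> card (F \<times> F)"
      unfolding F_def by (rule card_mono[OF _ sub]) simp
    then have "real (card {n. znorm n \<le> 2 * N}) \<le> real (card F) * real (card F)"
      by (simp add: card_cartesian_product flip: of_nat_mult)
    also have "\<dots> \<le> (5 * N) * (5 * N)"
      by (intro mult_mono F) (use N in auto)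
    finally show ?thesis
      by (simp add: power2_eq_square)
  qed
qed

text \<open>Rounding is done in the orthonormal basis \<open>e, e\<^sup>\<bottom>\<close> with \<open>e = b / \<bar>b\<bar>\<close>. Two lattice points that
  are rounded to the same cell differ by a lattice vector of squared length below \<open>2\<close>, that is, by one
  of the nine vectors with entries in \<open>{-1, 0, 1}\<close>. For \<open>b = 0\<close> the bound is the trivial one.\<close>
lemma card_phase_shift_le:
  assumes N: "1 \<le> N" and s: "s \<in> {1, -1}"
  shows "real (card {n. znorm n \<le> 2 * N \<and> \<bar>jbracket (n + b) + s * jbracket n - m\<bar> \<le> 1})
           \<le> 200000 * (N\<^sup>2 * (1 / sqrt N + 1 / sqrt (jbracket b)))"
    (is "real (card ?S) \<le> _")
proof (cases "b = 0")
  case True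
  have "real (card ?S) \<le> real (card {n. znorm n \<le> 2 * N})"
    using finite_znorm_le[of "2 * N"] by (intro of_nat_mono card_mono) auto
  also have "\<dots> \<le> 25 * N\<^sup>2"
    by (rule card_znorm_le[OF N])
  also have "\<dots> \<le> 200000 * (N\<^sup>2 * (1 / sqrt N + 1 / sqrt (jbracket b)))"
    using N by (simp add: True jbracket_def znorm_def distrib_left norm_Pair)
  finally show ?thesis .
next
  case False
  define b1 b2 where "b1 = real_of_int (fst b)" and "b2 = real_of_int (snd b)"
  define \<beta> where "\<beta> = znorm b"
  have \<beta>2: "\<beta> * \<beta> = b1\<^sup>2 + b2\<^sup>2"
    by (simp add: \<beta>_def znorm_def norm_Pair b1_def b2_def)
  have "1 \<le> b1\<^sup>2 + b2\<^sup>2"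
  proof -
    have "0 < (fst b)\<^sup>2 + (snd b)\<^sup>2"
      using False by (simp add: sum_power2_gt_zero_iff prod_eq_iff)
    then have "1 \<le> real_of_int ((fst b)\<^sup>2 + (snd b)\<^sup>2)"
      by linarith
    then show ?thesis
      by (simp add: b1_def b2_def)
  qed
  then have \<beta>: "1 \<le> \<beta>"
    by (simp add: \<beta>_def znorm_def norm_Pair b1_def b2_def)
  define e1 e2 where "e1 = b1 / \<beta>" and "e2 = b2 / \<beta>"
  have e: "e1\<^sup>2 + e2\<^sup>2 = 1" "\<beta> * e1 = b1" "\<beta> * e2 = b2"
    using \<beta> \<beta>2 by (auto simp: e1_def e2_def power_divide add_divide_distrib[symmetric] power2_eq_square[of \<beta>])
  \<comment> \<open>The coordinates along \<open>b\<close> and across \<open>b\<close>.\<close>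
  define X Y where "X n = e1 * real_of_int (fst n) + e2 * real_of_int (snd n)"
    and "Y n = e1 * real_of_int (snd n) - e2 * real_of_int (fst n)" for n :: "int \<times> int"
  have XY: "(X n)\<^sup>2 + (Y n)\<^sup>2 = (real_of_int (fst n))\<^sup>2 + (real_of_int (snd n))\<^sup>2" for n
  proof -
    have "(X n)\<^sup>2 + (Y n)\<^sup>2 = (e1\<^sup>2 + e2\<^sup>2) * ((real_of_int (fst n))\<^sup>2 + (real_of_int (snd n))\<^sup>2)"
      by (simp add: X_def Y_def power2_eq_square algebra_simps)
    then show ?thesis
      by (simp add: e)
  qed
  have rot: "jbracket n = bracket (X n) (Y n)" for n
    using XY[of n] by (simp add: jbracket_eq bracket_def add.assoc)
  have Xadd: "X (n + b) = X n + \<beta>" and Yadd: "Y (n + b) = Y n" for n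
  proof -
    have "X b = \<beta> * (e1\<^sup>2 + e2\<^sup>2)" "Y b = 0"
      using e(2,3)[symmetric]
      by (auto simp: X_def Y_def power2_eq_square algebra_simps simp flip: b1_def b2_def)
    then show "X (n + b) = X n + \<beta>" "Y (n + b) = Y n"
      using e(1) by (auto simp: X_def Y_def algebra_simps)
  qed
  define q where "q n = (\<lfloor>X n\<rfloor>, \<lfloor>Y n\<rfloor>)" for n
  \<comment> \<open>Rounding changes each bracket by at most \<open>2\<close>, which turns the tolerance \<open>1\<close> into \<open>5\<close>.\<close>
  define P where "P = {(i::int, j::int). bracket i j \<le> 5 * N \<and>
                  \<bar>bracket (i + \<beta>) j + s * bracket i j - m\<bar> \<le> 5}"
  have finS: "finite ?S"
    by (rule finite_subset[OF _ finite_znorm_le[of "2 * N"]]) auto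
  have img: "q ` ?S \<subseteq> P"
  proof (rule image_subsetI)
    fix n assume "n \<in> ?S"
    then have n: "znorm n \<le> 2 * N" "\<bar>jbracket (n + b) + s * jbracket n - m\<bar> \<le> 1"
      by auto
    have fl: "\<bar>real_of_int \<lfloor>X n\<rfloor> - X n\<bar> \<le> 1" "\<bar>real_of_int \<lfloor>Y n\<rfloor> - Y n\<bar> \<le> 1"
      by linarith+
    have 1: "\<bar>bracket \<lfloor>X n\<rfloor> \<lfloor>Y n\<rfloor> - jbracket n\<bar> \<le> 2"
      using bracket_lipschitz[of "\<lfloor>X n\<rfloor>" "\<lfloor>Y n\<rfloor>" "X n" "Y n"] fl by (simp add: rot)
    have 2: "\<bar>bracket (\<lfloor>X n\<rfloor> + \<beta>) \<lfloor>Y n\<rfloor> - jbracket (n + b)\<bar> \<le> 2"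
      using bracket_lipschitz[of "\<lfloor>X n\<rfloor> + \<beta>" "\<lfloor>Y n\<rfloor>" "X n + \<beta>" "Y n"] fl
      by (simp add: rot Xadd Yadd)
    have "jbracket n \<le> 1 + znorm n"
      unfolding jbracket_def using sqrt_sum_squares_le_sum[of 1 "znorm n"] by (simp add: znorm_def)
    then have "bracket \<lfloor>X n\<rfloor> \<lfloor>Y n\<rfloor> \<le> 5 * N"
      using 1 n(1) N by linarith
    moreover have "\<bar>bracket (\<lfloor>X n\<rfloor> + \<beta>) \<lfloor>Y n\<rfloor> + s * bracket \<lfloor>X n\<rfloor> \<lfloor>Y n\<rfloor> - m\<bar> \<le> 5"
      using 1 2 n(2) s by auto
    ultimately show "q n \<in> P"
      by (simp add: q_def P_def)
  qed
  have fibre: "real (card {n\<in>?S. q n = p}) \<le> 9" for p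
  proof (cases "{n\<in>?S. q n = p} = {}")
    case True
    then show ?thesis by (simp only: card.empty)
  next
    case False
    then obtain n0 where n0: "q n0 = p" by auto
    define U :: "int set" where "U = {-1, 0, 1}"
    have "{n\<in>?S. q n = p} \<subseteq> (+) n0 ` (U \<times> U)"
    proof
      fix n assume "n \<in> {n\<in>?S. q n = p}"
      then have "\<lfloor>X n\<rfloor> = \<lfloor>X n0\<rfloor>" "\<lfloor>Y n\<rfloor> = \<lfloor>Y n0\<rfloor>"
        using n0 by (auto simp: q_def)
      then have "\<bar>X n - X n0\<bar> < 1" "\<bar>Y n - Y n0\<bar> < 1"
        by linarith+
      moreover have "X n - X n0 = X (n - n0)" "Y n - Y n0 = Y (n - n0)"
        by (auto simp: X_def Y_def algebra_simps)
      ultimately have "(X (n - n0))\<^sup>2 < 1" "(Y (n - n0))\<^sup>2 < 1"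
        by (auto simp: abs_square_less_1)
      then have "real_of_int ((fst (n - n0))\<^sup>2 + (snd (n - n0))\<^sup>2) < 2"
        using XY[of "n - n0"] by simp
      then have lt: "(fst (n - n0))\<^sup>2 + (snd (n - n0))\<^sup>2 < 2"
        by linarith
      have "k \<in> U" if "k\<^sup>2 < 2" for k :: int
      proof -
        have "\<bar>k\<bar>\<^sup>2 < 2\<^sup>2"
          using that by simp
        then have "\<bar>k\<bar> < 2"
          by (rule power2_less_imp_less) simp
        then show ?thesis by (auto simp: U_def)
      qed
      then have "n - n0 \<in> U \<times> U"
        using lt zero_le_power2[of "fst (n - n0)"] zero_le_power2[of "snd (n - n0)"]
        by (metis add_increasing add_increasing2 le_less_trans mem_Times_iff order_refl)
      then have "n0 + (n - n0) \<in> (+) n0 ` (U \<times> U)"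
        by (rule imageI)
      then show "n \<in> (+) n0 ` (U \<times> U)"
        by simp
    qed
    then have "card {n\<in>?S. q n = p} \<le> card ((+) n0 ` (U \<times> U))"
      by (rule card_mono[rotated]) (simp add: U_def)
    also have "\<dots> \<le> card (U \<times> U)"
      by (rule card_image_le) (simp add: U_def)
    also have "\<dots> = 9"
      by (simp add: U_def card_cartesian_product)
    finally show ?thesis by simp
  qed
  have "real (card ?S) \<le> (\<Sum>p\<in>P. 9)"
    by (rule card_le_fibres[OF _ img fibre finS]) (use card_cells_le(1)[OF N \<beta> s] in \<open>simp add: P_def\<close>)
  also have "\<dots> = 9 * real (card P)"
    by simp
  also have "\<dots> \<le> 9 * (10000 * (N\<^sup>2 * (1 / sqrt N + 1 / sqrt \<beta>)))"
    unfolding P_def by (intro mult_left_mono card_cells_le(2)[OF N \<beta> s]) simp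
  also have "\<dots> \<le> 9 * (10000 * (N\<^sup>2 * (2 / sqrt N + 2 / sqrt (jbracket b))))"
  proof (intro mult_left_mono add_mono)
    have "jbracket b \<le> 1 + \<beta>"
      unfolding jbracket_def \<beta>_def using sqrt_sum_squares_le_sum[of 1 "znorm b"] by (simp add: znorm_def)
    then have "sqrt (jbracket b) \<le> sqrt (4 * \<beta>)"
      using \<beta> by simp
    then have "sqrt (jbracket b) \<le> 2 * sqrt \<beta>"
      by (simp add: real_sqrt_mult)
    moreover have "0 < sqrt (jbracket b)" "0 < sqrt \<beta>"
      using \<beta> bracket_ge(1) by (auto simp: jbracket_eq intro: less_le_trans[OF zero_less_one])
    ultimately show "1 / sqrt \<beta> \<le> 2 / sqrt (jbracket b)"
      by (simp add: field_simps)
  qed (use N in \<open>auto intro: divide_right_mono\<close>)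
  also have "\<dots> = 180000 * (N\<^sup>2 * (1 / sqrt N + 1 / sqrt (jbracket b)))"
    by (simp add: field_simps)
  also have "\<dots> \<le> 200000 * (N\<^sup>2 * (1 / sqrt N + 1 / sqrt (jbracket b)))"
    using N by (intro mult_right_mono) (auto simp: jbracket_def)
  finally show ?thesis .
qed

section \<open>From one frequency to triples\<close>

lemma jbracket_ge_one: "1 \<le> jbracket n"
  by (simp add: jbracket_def)

lemma jbracket_ge_znorm: "znorm n \<le> jbracket n"
  unfolding jbracket_def by (rule real_le_rsqrt) simp

lemma znorm_uminus: "znorm (- n) = znorm n"
  by (simp add: znorm_def norm_Pair)

lemma jbracket_uminus: "jbracket (- n) = jbracket n"
  by (simp add: jbracket_def znorm_uminus)

text \<open>Bounding \<open>\<langle>n + a\<rangle>\<close> from below by its first coordinate loses nothing in the order of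
  magnitude: the one-dimensional sum is \<open>O(sqrt N)\<close>, and the second coordinate takes \<open>O(N)\<close> values.\<close>
lemma sum_inverse_sqrt_jbracket_le:
  assumes N: "1 \<le> N"
  shows "(\<Sum>n\<in>{n. znorm n \<le> 2 * N}. 1 / sqrt (jbracket (n + a))) \<le> 105 * (N\<^sup>2 / sqrt N)"
proof -
  define F where "F = {- \<lfloor>2 * N\<rfloor>..\<lfloor>2 * N\<rfloor>}"
  define w where "w i = 1 / sqrt (max 1 \<bar>real_of_int i + real_of_int (fst a)\<bar>)" for i
  have "real (card F) \<le> 2 * (2 * N) + 1"
    using N by (simp add: F_def)
  then have F: "real (card F) \<le> 5 * N"
    using N by linarith
  then have "sqrt (real (card F)) \<le> sqrt (9 * N)"
    using N by simp
  then have sF: "sqrt (real (card F)) \<le> 3 * sqrt N"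
    by (simp add: real_sqrt_mult)
  have w0: "0 \<le> w i" for i
    by (simp add: w_def)
  have "(\<Sum>n\<in>{n. znorm n \<le> 2 * N}. 1 / sqrt (jbracket (n + a))) \<le>
        (\<Sum>n\<in>{n. znorm n \<le> 2 * N}. w (fst n))"
  proof (rule sum_mono)
    fix n
    have "max 1 \<bar>real_of_int (fst n) + real_of_int (fst a)\<bar> \<le> jbracket (n + a)"
      using bracket_ge(1,2)[of "real_of_int (fst (n + a))" "real_of_int (snd (n + a))"]
      by (simp add: jbracket_eq)
    then show "1 / sqrt (jbracket (n + a)) \<le> w (fst n)"
      unfolding w_def using jbracket_ge_one[of "n + a"] by (intro divide_left_mono) (auto simp: max_def)
  qed
  also have "\<dots> \<le> (\<Sum>n\<in>F \<times> F. w (fst n))"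
    unfolding F_def by (rule sum_mono2[OF _ znorm_le_subset]) (use w0 in auto)
  also have "\<dots> = (\<Sum>i\<in>F. \<Sum>j\<in>F. w i)"
    unfolding sum.cartesian_product by (simp add: case_prod_beta)
  also have "\<dots> = real (card F) * (\<Sum>i\<in>F. w i)"
    by (simp add: sum_distrib_left)
  also have "\<dots> \<le> (5 * N) * (7 * (3 * sqrt N))"
  proof (intro mult_mono F)
    show "(\<Sum>i\<in>F. w i) \<le> 7 * (3 * sqrt N)"
      using sum_int_inverse_sqrt_le[of F "real_of_int (fst a)"] sF by (simp add: w_def F_def)
  qed (use N w0 in \<open>auto intro: sum_nonneg\<close>)
  also have "\<dots> = 105 * (N\<^sup>2 / sqrt N)"
  proof -
    have "N * sqrt N = N\<^sup>2 / sqrt N"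
      using N by (simp add: field_simps power2_eq_square)
    then show ?thesis by simp
  qed
  finally show ?thesis .
qed

text \<open>The triples \<open>x\<close> are sorted by the two frequencies \<open>q x\<close> that are held fixed; the remaining one, \<open>h x\<close>,
  enters the phase through two brackets whose arguments differ by the shift \<open>b (q x)\<close>. Multiplying the
  phase by the sign \<open>u\<close> normalizes the coefficient of the shifted bracket to \<open>1\<close>.\<close>
lemma card_by_shift_le:
  fixes h :: "'x \<Rightarrow> int \<times> int" and q :: "'x \<Rightarrow> 'p"
  assumes "finite S" "finite P" "q ` S \<subseteq> P" and inj: "inj_on (\<lambda>x. (h x, q x)) S"
    and N: "1 \<le> N" and u: "u \<in> {1, -1}" and v: "v \<in> {1, -1}"
    and h: "\<And>x. x \<in> S \<Longrightarrow> znorm (h x) \<le> 2 * N"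
    and f: "\<And>x. x \<in> S \<Longrightarrow>
              \<bar>u * jbracket (h x + b (q x)) + v * jbracket (h x) - r (q x)\<bar> \<le> 1"
  shows "real (card S) \<le> (\<Sum>p\<in>P. 200000 * (N\<^sup>2 * (1 / sqrt N + 1 / sqrt (jbracket (b p)))))"
proof (rule card_le_fibres[OF assms(2,3) _ assms(1)])
  fix p
  let ?R = "{n. znorm n \<le> 2 * N \<and> \<bar>jbracket (n + b p) + (u * v) * jbracket n - u * r p\<bar> \<le> 1}"
  have "card {x\<in>S. q x = p} \<le> card ?R"
  proof (rule card_inj_on_le)
    show "inj_on h {x\<in>S. q x = p}"
      using inj by (auto simp: inj_on_def)
    show "h ` {x\<in>S. q x = p} \<subseteq> ?R"
    proof (rule image_subsetI)
      fix x assume "x \<in> {x\<in>S. q x = p}"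
      then have x: "x \<in> S" "q x = p" by auto
      have "\<bar>jbracket (h x + b p) + (u * v) * jbracket (h x) - u * r p\<bar> \<le> 1"
        using f[OF x(1)] u x(2) by auto
      then show "h x \<in> ?R"
        using h[OF x(1)] by simp
    qed
    show "finite ?R"
      by (rule finite_subset[OF _ finite_znorm_le[of "2 * N"]]) auto
  qed
  then show "real (card {x\<in>S. q x = p}) \<le> 200000 * (N\<^sup>2 * (1 / sqrt N + 1 / sqrt (jbracket (b p))))"
    using card_phase_shift_le[OF N, of "u * v" "b p" "u * r p"] u v by fastforce
qed

definition sum_triples ::
  "real \<Rightarrow> real \<Rightarrow> real \<Rightarrow> real \<Rightarrow> real \<Rightarrow> real \<Rightarrow> real \<Rightarrow> real \<Rightarrow> ((int \<times> int) \<times> (int \<times> int) \<times> (int \<times> int)) set" where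
  "sum_triples s s1 s2 s3 N1 N2 N3 m = {(n1, n2, n3). \<bar>phase s s1 s2 s3 n1 n2 n3 - m\<bar> \<le> 1 \<and>
     at_scale n1 N1 \<and> at_scale n2 N2 \<and> at_scale n3 N3}"

lemma finite_sum_triples: "finite (sum_triples s s1 s2 s3 N1 N2 N3 m)"
  unfolding sum_triples_def by (rule finite_scale_triples)

lemma card_sum_triples_swap12:
  "card (sum_triples s s1 s2 s3 N1 N2 N3 m) \<le> card (sum_triples s s2 s1 s3 N2 N1 N3 m)"
  by (rule card_inj_on_le[where f = "\<lambda>(a, b, c). (b, a, c)"])
    (auto simp: inj_on_def sum_triples_def phase_def finite_scale_triples add_ac)

lemma card_sum_triples_swap23:
  "card (sum_triples s s1 s2 s3 N1 N2 N3 m) \<le> card (sum_triples s s1 s3 s2 N1 N3 N2 m)"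
  by (rule card_inj_on_le[where f = "\<lambda>(a, b, c). (a, c, b)"])
    (auto simp: inj_on_def sum_triples_def phase_def finite_scale_triples add_ac)

text \<open>Here \<open>n\<^sub>1\<close> is counted with shift \<open>n\<^sub>2 + n\<^sub>3\<close>. The shift may be small for some \<open>n\<^sub>2\<close>, but on average
  over \<open>n\<^sub>2\<close> it has order of magnitude at least \<open>N\<^sub>2\<close>, wherever \<open>n\<^sub>3\<close> is. This is why any pair of
  scales can later play the role of \<open>N\<^sub>1\<close> and \<open>N\<^sub>2\<close>.\<close>
lemma card_sum_triples_le_second:
  assumes signs: "s \<in> {1, -1}" "s1 \<in> {1, -1}" and N: "1 \<le> N2" "N2 \<le> N1" "1 \<le> N3"
  shows "real (card (sum_triples s s1 s2 s3 N1 N2 N3 m)) \<le> 1000000000 * ((N1 * N2 * N3)\<^sup>2 / sqrt N2)"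
proof -
  define Z where "Z N = {n. znorm n \<le> 2 * N}" for N
  have Z: "finite (Z N)" "1 \<le> N \<Longrightarrow> real (card (Z N)) \<le> 25 * N\<^sup>2" for N
    using finite_znorm_le card_znorm_le by (auto simp: Z_def)
  define B where "B = N2\<^sup>2 / sqrt N2"
  have B: "0 \<le> B"
    using N by (simp add: B_def)
  have "real (card (sum_triples s s1 s2 s3 N1 N2 N3 m)) \<le>
      (\<Sum>p\<in>Z N3 \<times> Z N2. 200000 * (N1\<^sup>2 * (1 / sqrt N1 + 1 / sqrt (jbracket (snd p + fst p)))))"
  proof (rule card_by_shift_le[where u = s and v = s1 and h = "\<lambda>(n1, n2, n3). n1" and b = "\<lambda>p. snd p + fst p" and q = "\<lambda>(n1, n2, n3). (n3, n2)"
        and r = "\<lambda>(n3, n2). m - s2 * jbracket n2 - s3 * jbracket n3",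
        OF finite_sum_triples])
    show "1 \<le> N1" using N by simp
  qed (use signs Z in \<open>auto simp: sum_triples_def finite_scale_triples inj_on_def Z_def
      at_scale_def phase_def add.assoc algebra_simps\<close>)
  also have "\<dots> = 200000 * N1\<^sup>2 * (\<Sum>n3\<in>Z N3. \<Sum>n2\<in>Z N2. 1 / sqrt N1 + 1 / sqrt (jbracket (n2 + n3)))"
    by (simp add: sum.cartesian_product sum_distrib_left case_prod_beta mult.assoc)
  also have "\<dots> \<le> 200000 * N1\<^sup>2 * (\<Sum>n3\<in>Z N3. 130 * B)"
  proof (intro mult_left_mono sum_mono)
    fix n3
    have "real (card (Z N2)) * (1 / sqrt N1) \<le> (25 * N2\<^sup>2) * (1 / sqrt N2)"
      by (intro mult_mono Z) (use N in \<open>auto intro!: divide_left_mono\<close>)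
    then show "(\<Sum>n2\<in>Z N2. 1 / sqrt N1 + 1 / sqrt (jbracket (n2 + n3))) \<le> 130 * B"
      using sum_inverse_sqrt_jbracket_le[OF N(1), of n3] by (simp add: sum.distrib B_def Z_def)
  qed simp
  also have "\<dots> = 200000 * N1\<^sup>2 * (real (card (Z N3)) * (130 * B))"
    by simp
  also have "\<dots> \<le> 200000 * N1\<^sup>2 * (25 * N3\<^sup>2 * (130 * B))"
    using B by (intro mult_left_mono mult_right_mono Z(2) N(3)) auto
  also have "\<dots> = 650000000 * ((N1 * N2 * N3)\<^sup>2 / sqrt N2)"
    by (simp add: B_def power_mult_distrib)
  also have "\<dots> \<le> 1000000000 * ((N1 * N2 * N3)\<^sup>2 / sqrt N2)"
    using N by (intro mult_right_mono) auto
  finally show ?thesis .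
qed

text \<open>The median is the minimum of the two largest numbers. For the counting bound it is enough that it is the
  minimum of some pair, since each pair of scales may be used.\<close>
lemma med_eq_min:
  "med a b c = min a b \<or> med a b c = min b c \<or> med a b c = min a c"
  unfolding med_def by auto

lemma card_sum_triples_le:
  assumes s: "s \<in> {1, -1}" "s1 \<in> {1, -1}" "s2 \<in> {1, -1}" "s3 \<in> {1, -1}"
    and N: "1 \<le> N1" "1 \<le> N2" "1 \<le> N3"
  shows "real (card (sum_triples s s1 s2 s3 N1 N2 N3 m))
           \<le> 1000000000 * ((N1 * N2 * N3)\<^sup>2 / sqrt (med N1 N2 N3))"
proof -
  have first_two: "real (card (sum_triples s t1 t2 t3 M1 M2 M3 m))
      \<le> 1000000000 * ((M1 * M2 * M3)\<^sup>2 / sqrt (min M1 M2))"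
    if "t1 \<in> {1, -1}" "t2 \<in> {1, -1}" "1 \<le> M1" "1 \<le> M2" "1 \<le> M3" for t1 t2 t3 M1 M2 M3
  proof (cases "M2 \<le> M1")
    case True
    then show ?thesis
      using card_sum_triples_le_second[OF s(1) that(1,4) True that(5)] by (simp add: min_absorb2)
  next
    case False
    then have "M1 \<le> M2" by simp
    have "real (card (sum_triples s t1 t2 t3 M1 M2 M3 m)) \<le> real (card (sum_triples s t2 t1 t3 M2 M1 M3 m))"
      by (rule of_nat_mono) (rule card_sum_triples_swap12)
    also have "\<dots> \<le> 1000000000 * ((M2 * M1 * M3)\<^sup>2 / sqrt M1)"
      by (rule card_sum_triples_le_second[OF s(1) that(2,3) \<open>M1 \<le> M2\<close> that(5)])
    finally show ?thesis
      using False by (simp add: mult_ac)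
  qed
  have 13: "real (card (sum_triples s s1 s2 s3 N1 N2 N3 m)) \<le> 1000000000 * ((N1 * N3 * N2)\<^sup>2 / sqrt (min N1 N3))"
    by (rule order_trans[OF of_nat_mono[OF card_sum_triples_swap23] first_two]) (use s N in auto)
  have 23: "real (card (sum_triples s s1 s2 s3 N1 N2 N3 m)) \<le> 1000000000 * ((N2 * N3 * N1)\<^sup>2 / sqrt (min N2 N3))"
    by (rule order_trans[OF of_nat_mono[OF order_trans[OF card_sum_triples_swap12 card_sum_triples_swap23]] first_two])
      (use s N in auto)
  show ?thesis
    using med_eq_min[of N1 N2 N3] first_two[OF s(2,3) N] 13 23 by (auto simp: mult_ac)
qed

definition pair_sum_triples ::
  "real \<Rightarrow> real \<Rightarrow> real \<Rightarrow> real \<Rightarrow> real \<Rightarrow> real \<Rightarrow> real \<Rightarrow> real \<Rightarrow> ((int \<times> int) \<times> (int \<times> int) \<times> (int \<times> int)) set" where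
  "pair_sum_triples s s2 s3 s4 N2 N3 N34 m =
     {(n2, n3, n34). \<bar>phase s s2 s3 s4 n2 n3 (n34 - n3) - m\<bar> \<le> 1 \<and>
        at_scale n2 N2 \<and> at_scale n3 N3 \<and> at_scale n34 N34}"

lemma finite_pair_sum_triples: "finite (pair_sum_triples s s2 s3 s4 N2 N3 N34 m)"
  unfolding pair_sum_triples_def by (rule finite_scale_triples)

text \<open>When the shift is itself one of the localized frequencies, the lower bound in \<open>at_scale\<close> gives
  \<open>\<langle>b\<rangle> \<ge> M / 2\<close> pointwise, and no averaging is needed.\<close>
lemma card_by_large_shift_le:
  fixes h :: "'x \<Rightarrow> int \<times> int" and q :: "'x \<Rightarrow> (int \<times> int) \<times> (int \<times> int)"
  assumes "finite S" and inj: "inj_on (\<lambda>x. (h x, q x)) S"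
    and N: "1 \<le> N" "1 \<le> N'" "1 \<le> M" and u: "u \<in> {1, -1}" and v: "v \<in> {1, -1}"
    and h: "\<And>x. x \<in> S \<Longrightarrow> znorm (h x) \<le> 2 * N"
    and q: "\<And>x. x \<in> S \<Longrightarrow> at_scale (fst (q x)) N'" "\<And>x. x \<in> S \<Longrightarrow> at_scale (snd (q x)) M"
    and f: "\<And>x. x \<in> S \<Longrightarrow>
              \<bar>u * jbracket (h x + snd (q x)) + v * jbracket (h x) - r (q x)\<bar> \<le> 1"
  shows "real (card S) \<le> 1000000000 * ((N * N' * M)\<^sup>2 / sqrt (min M N))"
proof -
  define P where "P = {n. at_scale n N'} \<times> {n. at_scale n M}"
  define \<mu> where "\<mu> = min M N"
  have \<mu>: "1 \<le> \<mu>" "\<mu> \<le> M" "\<mu> \<le> N"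
    using N by (auto simp: \<mu>_def)
  have finP: "finite P"
    by (simp add: P_def finite_at_scale)
  have shell: "real (card {n. at_scale n K}) \<le> 25 * K\<^sup>2" if "1 \<le> K" for K
  proof -
    have "card {n. at_scale n K} \<le> card {n. znorm n \<le> 2 * K}"
      by (intro card_mono finite_znorm_le) (auto simp: at_scale_def)
    then show ?thesis
      using card_znorm_le[OF that] by linarith
  qed
  have "real (card S) \<le> (\<Sum>p\<in>P. 200000 * (N\<^sup>2 * (1 / sqrt N + 1 / sqrt (jbracket (snd p)))))"
    by (rule card_by_shift_le[OF assms(1) finP _ inj N(1) u v h f])
      (intro image_subsetI; simp add: P_def mem_Times_iff q)
  also have "\<dots> \<le> (\<Sum>p\<in>P. 200000 * (N\<^sup>2 * (1 / sqrt \<mu> + 2 / sqrt \<mu>)))"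
  proof (intro sum_mono mult_left_mono add_mono)
    fix p assume "p \<in> P"
    then have "\<mu> \<le> 4 * jbracket (snd p)"
      using jbracket_ge_znorm[of "snd p"] \<mu> by (auto simp: P_def at_scale_def)
    then have "sqrt \<mu> \<le> sqrt (4 * jbracket (snd p))"
      by simp
    then have "sqrt \<mu> \<le> 2 * sqrt (jbracket (snd p))"
      by (simp add: real_sqrt_mult)
    moreover have "0 < sqrt \<mu>" "0 < sqrt (jbracket (snd p))"
      using \<mu> jbracket_ge_one[of "snd p"] by auto
    ultimately show "1 / sqrt (jbracket (snd p)) \<le> 2 / sqrt \<mu>"
      by (simp add: field_simps)
  qed (use \<mu> in \<open>auto intro!: divide_left_mono\<close>)
  also have "\<dots> = real (card P) * (600000 * (N\<^sup>2 / sqrt \<mu>))"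
    by simp
  also have "\<dots> \<le> ((25 * N'\<^sup>2) * (25 * M\<^sup>2)) * (600000 * (N\<^sup>2 / sqrt \<mu>))"
  proof (rule mult_right_mono)
    show "real (card P) \<le> (25 * N'\<^sup>2) * (25 * M\<^sup>2)"
      unfolding P_def card_cartesian_product of_nat_mult
      by (intro mult_mono shell N) auto
  qed (use \<mu> in simp)
  also have "\<dots> = 375000000 * ((N * N' * M)\<^sup>2 / sqrt \<mu>)"
    by (simp add: power_mult_distrib)
  also have "\<dots> \<le> 1000000000 * ((N * N' * M)\<^sup>2 / sqrt \<mu>)"
    using \<mu> by (intro mult_right_mono) auto
  finally show ?thesis
    by (simp add: \<mu>_def)
qed

text \<open>The larger of the scales \<open>N\<^sub>2\<close> and \<open>N\<^sub>3\<close> decides which frequency is counted. For \<open>n\<^sub>2\<close> the two brackets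
  are \<open>\<langle>n\<^sub>2 + n\<^sub>3\<^sub>4\<rangle>\<close> and \<open>\<langle>n\<^sub>2\<rangle>\<close>, for \<open>-n\<^sub>3\<close> they are \<open>\<langle>-n\<^sub>3 + n\<^sub>3\<^sub>4\<rangle>\<close> and \<open>\<langle>n\<^sub>3\<rangle>\<close>.\<close>
lemma card_pair_sum_triples_le:
  assumes s: "s \<in> {1, -1}" "s2 \<in> {1, -1}" "s3 \<in> {1, -1}" "s4 \<in> {1, -1}"
    and N: "1 \<le> N2" "1 \<le> N3" "1 \<le> N34"
  shows "real (card (pair_sum_triples s s2 s3 s4 N2 N3 N34 m))
           \<le> 1000000000 * ((N2 * N3 * N34)\<^sup>2 / sqrt (min N34 (max N2 N3)))"
    (is "real (card ?S) \<le> _")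
proof -
  show ?thesis
  proof (cases "N3 \<le> N2")
    case True
    have "real (card ?S) \<le> 1000000000 * ((N2 * N3 * N34)\<^sup>2 / sqrt (min N34 N2))"
      by (rule card_by_large_shift_le[where h = "\<lambda>(n2, n3, n34). n2" and q = "\<lambda>(n2, n3, n34). (n3, n34)"
            and r = "\<lambda>(n3, n34). m - s3 * jbracket n3 - s4 * jbracket (n34 - n3)", OF finite_pair_sum_triples _ N s(1,2)])
        (auto simp: pair_sum_triples_def inj_on_def at_scale_def phase_def algebra_simps)
    then show ?thesis
      using True by (simp add: max_def)
  next
    case False
    have flip: "jbracket (- n - k) = jbracket (n + k)" for n k
      using jbracket_uminus[of "n + k"] by simp
    have "real (card ?S) \<le> 1000000000 * ((N3 * N2 * N34)\<^sup>2 / sqrt (min N34 N3))"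
      by (rule card_by_large_shift_le[where h = "\<lambda>(n2, n3, n34). - n3" and q = "\<lambda>(n2, n3, n34). (n2, n34)"
            and r = "\<lambda>(n2, n34). m - s * jbracket (n2 + n34) - s2 * jbracket n2",
            OF finite_pair_sum_triples _ N(2,1,3) s(4,3)])
        (auto simp: pair_sum_triples_def inj_on_def at_scale_def phase_def algebra_simps znorm_uminus jbracket_uminus flip
          simp del: uminus_Pair add_Pair diff_Pair)
    then show ?thesis
      using False by (simp add: max_def mult_ac)
  qed
qed

lemma dyadic_ge_one: "dyadic N \<Longrightarrow> 1 \<le> N"
  by (auto simp: dyadic_def)

theorem lemma10p5:
  fixes \<sigma> \<sigma>1 \<sigma>2 \<sigma>3 \<sigma>4 :: real
  assumes "\<sigma> \<in> {1, -1}" "\<sigma>1 \<in> {1, -1}" "\<sigma>2 \<in> {1, -1}" "\<sigma>3 \<in> {1, -1}" "\<sigma>4 \<in> {1, -1}"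
  shows
    "(\<exists>C>0. \<forall>N1 N2 N3. dyadic N1 \<longrightarrow> dyadic N2 \<longrightarrow> dyadic N3 \<longrightarrow>
        (SUP m::int. ereal (real (card {(n1, n2, n3).
            \<bar>phase \<sigma> \<sigma>1 \<sigma>2 \<sigma>3 n1 n2 n3 - real_of_int m\<bar> \<le> 1 \<and>
            at_scale n1 N1 \<and> at_scale n2 N2 \<and> at_scale n3 N3})))
        \<le> ereal (C * ((N1 * N2 * N3)\<^sup>2 / med N1 N2 N3 powr (1 / 2))))
   \<and> (\<exists>C>0. \<forall>N123 N1 N2. dyadic N123 \<longrightarrow> dyadic N1 \<longrightarrow> dyadic N2 \<longrightarrow>
        (SUP m::int. ereal (real (card {(n1, n2, n123).
            \<bar>phase \<sigma> \<sigma>1 \<sigma>2 \<sigma>3 n1 n2 (n123 - n1 - n2) - real_of_int m\<bar> \<le> 1 \<and>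
            at_scale n1 N1 \<and> at_scale n2 N2 \<and> at_scale n123 N123})))
        \<le> ereal (C * ((N123 * N1 * N2)\<^sup>2 / med N123 N1 N2 powr (1 / 2))))
   \<and> (\<exists>C>0. \<forall>N2 N3 N34. dyadic N2 \<longrightarrow> dyadic N3 \<longrightarrow> dyadic N34 \<longrightarrow>
        (SUP m::int. ereal (real (card {(n2, n3, n34).
            \<bar>phase \<sigma> \<sigma>2 \<sigma>3 \<sigma>4 n2 n3 (n34 - n3) - real_of_int m\<bar> \<le> 1 \<and>
            at_scale n2 N2 \<and> at_scale n3 N3 \<and> at_scale n34 N34})))
        \<le> ereal (C * ((N2 * N3 * N34)\<^sup>2 / min N34 (max N2 N3) powr (1 / 2))))
   \<and> (\<exists>C>0. \<forall>N3 N34 N234. dyadic N3 \<longrightarrow> dyadic N34 \<longrightarrow> dyadic N234 \<longrightarrow>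
        (SUP m::int. ereal (real (card {(n3, n34, n234).
            \<bar>phase \<sigma> \<sigma>2 \<sigma>3 \<sigma>4 (n234 - n34) n3 (n34 - n3) - real_of_int m\<bar> \<le> 1 \<and>
            at_scale n3 N3 \<and> at_scale n34 N34 \<and> at_scale n234 N234})))
        \<le> ereal (C * ((N3 * N34 * N234)\<^sup>2 / min N34 (max N3 N234) powr (1 / 2))))"
proof (intro conjI exI[of _ 1000000000] allI impI SUP_least)
  fix N1 N2 N3 :: real and m :: int
  assume N: "dyadic N1" "dyadic N2" "dyadic N3"
  then have "0 \<le> med N1 N2 N3"
    using med_eq_min[of N1 N2 N3] by (auto dest!: dyadic_ge_one)
  then show "ereal (real (card {(n1, n2, n3).
            \<bar>phase \<sigma> \<sigma>1 \<sigma>2 \<sigma>3 n1 n2 n3 - real_of_int m\<bar> \<le> 1 \<and>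
            at_scale n1 N1 \<and> at_scale n2 N2 \<and> at_scale n3 N3}))
        \<le> ereal (1000000000 * ((N1 * N2 * N3)\<^sup>2 / med N1 N2 N3 powr (1 / 2)))"
    using card_sum_triples_le[OF assms(1-4) N[THEN dyadic_ge_one]]
    by (simp add: powr_half_sqrt sum_triples_def)
next
  fix N123 N1 N2 :: real and m :: int
  assume N: "dyadic N123" "dyadic N1" "dyadic N2"
  let ?S = "{(n1, n2, n123). \<bar>phase \<sigma> \<sigma>1 \<sigma>2 \<sigma>3 n1 n2 (n123 - n1 - n2) - real_of_int m\<bar> \<le> 1 \<and>
            at_scale n1 N1 \<and> at_scale n2 N2 \<and> at_scale n123 N123}"
  have flip: "jbracket (n1 + (n2 - n)) = jbracket (n - n1 - n2)" for n n1 n2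
    using jbracket_uminus[of "n - n1 - n2"] by (simp add: algebra_simps)
  \<comment> \<open>With \<open>n\<^sub>0 = -n\<^sub>1\<^sub>2\<^sub>3\<close>, the dependent frequency is \<open>n\<^sub>3 = -(n\<^sub>0 + n\<^sub>1 + n\<^sub>2)\<close>, so \<open>\<sigma>3\<close> becomes the
    sign of the sum.\<close>
  have "card ?S \<le> card (sum_triples \<sigma>3 \<sigma> \<sigma>1 \<sigma>2 N123 N1 N2 (real_of_int m))"
    by (rule card_inj_on_le[where f = "\<lambda>(n1, n2, n123). (- n123, n1, n2)", OF _ _ finite_sum_triples])
      (auto simp: inj_on_def sum_triples_def phase_def at_scale_def znorm_uminus jbracket_uminus flip add_ac
        simp del: uminus_Pair add_Pair diff_Pair)
  also have "real \<dots> \<le> 1000000000 * ((N123 * N1 * N2)\<^sup>2 / sqrt (med N123 N1 N2))"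
    by (intro card_sum_triples_le assms N[THEN dyadic_ge_one])
  finally have "real (card ?S) \<le> 1000000000 * ((N123 * N1 * N2)\<^sup>2 / sqrt (med N123 N1 N2))"
    by simp
  moreover have "0 \<le> med N123 N1 N2"
    using N med_eq_min[of N123 N1 N2] by (auto dest!: dyadic_ge_one)
  ultimately show "ereal (real (card ?S)) \<le> ereal (1000000000 * ((N123 * N1 * N2)\<^sup>2 / med N123 N1 N2 powr (1 / 2)))"
    by (simp add: powr_half_sqrt)
next
  fix N2 N3 N34 :: real and m :: int
  assume N: "dyadic N2" "dyadic N3" "dyadic N34"
  then have "0 \<le> min N34 (max N2 N3)"
    by (auto dest!: dyadic_ge_one)
  then show "ereal (real (card {(n2, n3, n34).
            \<bar>phase \<sigma> \<sigma>2 \<sigma>3 \<sigma>4 n2 n3 (n34 - n3) - real_of_int m\<bar> \<le> 1 \<and>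
            at_scale n2 N2 \<and> at_scale n3 N3 \<and> at_scale n34 N34}))
        \<le> ereal (1000000000 * ((N2 * N3 * N34)\<^sup>2 / min N34 (max N2 N3) powr (1 / 2)))"
    using card_pair_sum_triples_le[OF assms(1,3,4,5) N[THEN dyadic_ge_one]]
    by (simp add: powr_half_sqrt pair_sum_triples_def)
next
  fix N3 N34 N234 :: real and m :: int
  assume N: "dyadic N3" "dyadic N34" "dyadic N234"
  let ?S = "{(n3, n34, n234). \<bar>phase \<sigma> \<sigma>2 \<sigma>3 \<sigma>4 (n234 - n34) n3 (n34 - n3) - real_of_int m\<bar> \<le> 1 \<and>
            at_scale n3 N3 \<and> at_scale n34 N34 \<and> at_scale n234 N234}"
  have flip: "jbracket (n34 - n234) = jbracket (n234 - n34)" for n34 n234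
    using jbracket_uminus[of "n234 - n34"] by simp
  \<comment> \<open>With \<open>-n\<^sub>2\<^sub>3\<^sub>4\<close> in the place of \<open>n\<^sub>2\<close>, its sum with \<open>n\<^sub>3\<^sub>4\<close> is \<open>-n\<^sub>2\<close>, so \<open>\<sigma>\<close> and \<open>\<sigma>2\<close> change places.\<close>
  have "card ?S \<le> card (pair_sum_triples \<sigma>2 \<sigma> \<sigma>3 \<sigma>4 N234 N3 N34 (real_of_int m))"
    by (rule card_inj_on_le[where f = "\<lambda>(n3, n34, n234). (- n234, n3, n34)", OF _ _ finite_pair_sum_triples])
      (auto simp: inj_on_def pair_sum_triples_def phase_def at_scale_def znorm_uminus jbracket_uminus flip
        add_ac simp del: uminus_Pair add_Pair diff_Pair)
  also have "real \<dots> \<le> 1000000000 * ((N234 * N3 * N34)\<^sup>2 / sqrt (min N34 (max N234 N3)))"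
    by (intro card_pair_sum_triples_le assms N[THEN dyadic_ge_one])
  finally have "real (card ?S) \<le> 1000000000 * ((N3 * N34 * N234)\<^sup>2 / sqrt (min N34 (max N3 N234)))"
    by (simp add: mult_ac max.commute)
  moreover have "0 \<le> min N34 (max N3 N234)"
    using N by (auto dest!: dyadic_ge_one)
  ultimately show "ereal (real (card ?S)) \<le> ereal (1000000000 * ((N3 * N34 * N234)\<^sup>2 / min N34 (max N3 N234) powr (1 / 2)))"
    by (simp add: powr_half_sqrt)
qed simp_all

end
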